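(* Let $S=k[x_1,\dots,x_n]$ be a standard graded polynomial ring over a field $k$, where $n\ge2$. Then there exists a degree $2$ free differential $S$-module $D$ of rank $2^{n-1}$ with $H(D)\cong k$.
   Context: A degree $a$ differential $S$-module is a graded $S$-module $D$ with a homogeneous (degree-preserving) $S$-linear map $d\colon D\to D(a)$ that squares to zero, i.e. $d(a)\circ d=0$; its homology is $H(D)=\ker(d)/\operatorname{im}(d(-a))$. It is free if the underlying module $D$ is a free $S$-module. Here $k=S/(x_1,\dots,x_n)$. *)

theory Defs
  imports "HOL-Library.Poly_Mapping" "HOL-Algebra.Ideal" "HOL-Algebra.Module"
begin

section \<open>The standard graded polynomial ring\<close>

text \<open>
  A polynomial is a finitely supported function from monomials to coefficients, a monomial being a
  finitely supported exponent vector; the product of \<^typ>\<open>'a \<Rightarrow>\<^sub>0 'b\<close> is convolution.  Cutting down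
  to monomials in the variables with indices \<open>1, \<dots>, n\<close> gives \<open>k[x\<^sub>1, \<dots>, x\<^sub>n]\<close>.
\<close>

type_synonym 'k mpoly = "(nat \<Rightarrow>\<^sub>0 nat) \<Rightarrow>\<^sub>0 'k"

definition polynomial_ring :: "nat \<Rightarrow> ('k::field) mpoly ring" where
  "polynomial_ring n =
    \<lparr>carrier = {p. \<forall>m \<in> Poly_Mapping.keys p. Poly_Mapping.keys m \<subseteq> {1..n}},
     monoid.mult = (*), one = 1, ring.zero = 0, add = (+)\<rparr>"

definition variable :: "nat \<Rightarrow> ('k::field) mpoly" where
  "variable i = Poly_Mapping.single (Poly_Mapping.single i 1) 1"

definition monomial_degree :: "(nat \<Rightarrow>\<^sub>0 nat) \<Rightarrow> nat" where
  "monomial_degree m = (\<Sum>i \<in> Poly_Mapping.keys m. Poly_Mapping.lookup m i)"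

definition polynomial_grading :: "nat \<Rightarrow> int \<Rightarrow> ('k::field) mpoly set" where
  "polynomial_grading n j =
    {p \<in> carrier (polynomial_ring n).
      \<forall>m \<in> Poly_Mapping.keys p. int (monomial_degree m) = j}"


section \<open>Modules: homomorphisms, quotients, free modules\<close>

definition mod_hom :: "('a, 'r) ring_scheme \<Rightarrow> ('a, 'b, 'm) module_scheme \<Rightarrow>
    ('a, 'c, 'l) module_scheme \<Rightarrow> ('b \<Rightarrow> 'c) set" where
  "mod_hom R M N =
    {f \<in> carrier M \<rightarrow> carrier N.
      (\<forall>x \<in> carrier M. \<forall>y \<in> carrier M. f (x \<oplus>\<^bsub>M\<^esub> y) = f x \<oplus>\<^bsub>N\<^esub> f y) \<and>
      (\<forall>r \<in> carrier R. \<forall>x \<in> carrier M. f (r \<odot>\<^bsub>M\<^esub> x) = r \<odot>\<^bsub>N\<^esub> f x)}"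

text \<open>
  The type of modules extends that of rings, so a module record also has fields \<^const>\<open>monoid.mult\<close> and
  \<^const>\<open>one\<close>; they carry no meaning for a module.
\<close>

definition regular_module :: "('a, 'r) ring_scheme \<Rightarrow> ('a, 'a) module" where
  "regular_module R =
    \<lparr>carrier = carrier R, monoid.mult = monoid.mult R, one = one R, ring.zero = ring.zero R, add = add R,
     smult = monoid.mult R\<rparr>"

definition quotient_module :: "('a, 'b, 'm) module_scheme \<Rightarrow> 'b set \<Rightarrow> ('a, 'b set) module" where
  "quotient_module M N =
    \<lparr>carrier = a_rcosets\<^bsub>M\<^esub> N, monoid.mult = undefined, one = undefined, ring.zero = N, add = set_add M,
     smult = (\<lambda>r A. \<Union>x \<in> A. N +>\<^bsub>M\<^esub> (r \<odot>\<^bsub>M\<^esub> x))\<rparr>"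

definition basis :: "('a, 'r) ring_scheme \<Rightarrow> ('a, 'b, 'm) module_scheme \<Rightarrow> 'b set \<Rightarrow> bool" where
  "basis R M B \<longleftrightarrow> finite B \<and> B \<subseteq> carrier M \<and>
    (\<forall>x \<in> carrier M. \<exists>!c. c \<in> B \<rightarrow>\<^sub>E carrier R \<and> x = (\<Oplus>\<^bsub>M\<^esub>b \<in> B. c b \<odot>\<^bsub>M\<^esub> b))"

definition free_of_rank :: "('a, 'r) ring_scheme \<Rightarrow> ('a, 'b, 'm) module_scheme \<Rightarrow> nat \<Rightarrow> bool" where
  "free_of_rank R M r \<longleftrightarrow> (\<exists>B. basis R M B \<and> card B = r)"


section \<open>Graded modules\<close>

locale graded_module = module R M
  for R :: "('a, 'r) ring_scheme" (structure) and Rg :: "int \<Rightarrow> 'a set"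
    and M :: "('a, 'b, 'm) module_scheme" (structure) and Mg :: "int \<Rightarrow> 'b set" +
  assumes component_subgroup: "additive_subgroup (Mg j) M"
    and direct_sum: "x \<in> carrier M \<Longrightarrow>
      \<exists>!c. (\<forall>j. c j \<in> Mg j) \<and> finite {j. c j \<noteq> \<zero>\<^bsub>M\<^esub>} \<and>
           x = (\<Oplus>\<^bsub>M\<^esub>j \<in> {j. c j \<noteq> \<zero>\<^bsub>M\<^esub>}. c j)"
    and smult_component: "r \<in> Rg i \<Longrightarrow> x \<in> Mg j \<Longrightarrow> r \<odot>\<^bsub>M\<^esub> x \<in> Mg (i + j)"

definition shift_grading :: "int \<Rightarrow> (int \<Rightarrow> 'b set) \<Rightarrow> int \<Rightarrow> 'b set" where
  "shift_grading a Mg j = Mg (a + j)"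

definition quotient_grading :: "('a, 'b, 'm) module_scheme \<Rightarrow> 'b set \<Rightarrow> (int \<Rightarrow> 'b set) \<Rightarrow>
    int \<Rightarrow> 'b set set" where
  "quotient_grading M N Mg j = (\<lambda>x. N +>\<^bsub>M\<^esub> x) ` Mg j"

definition graded_hom :: "('a, 'r) ring_scheme \<Rightarrow>
    ('a, 'b, 'm) module_scheme \<Rightarrow> (int \<Rightarrow> 'b set) \<Rightarrow>
    ('a, 'c, 'l) module_scheme \<Rightarrow> (int \<Rightarrow> 'c set) \<Rightarrow> ('b \<Rightarrow> 'c) set" where
  "graded_hom R M Mg N Ng = {f \<in> mod_hom R M N. \<forall>j. f ` Mg j \<subseteq> Ng j}"

definition graded_iso :: "('a, 'r) ring_scheme \<Rightarrow>
    ('a, 'b, 'm) module_scheme \<Rightarrow> (int \<Rightarrow> 'b set) \<Rightarrow>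
    ('a, 'c, 'l) module_scheme \<Rightarrow> (int \<Rightarrow> 'c set) \<Rightarrow> bool" where
  "graded_iso R M Mg N Ng \<longleftrightarrow>
    (\<exists>f \<in> mod_hom R M N. bij_betw f (carrier M) (carrier N) \<and> (\<forall>j. f ` Mg j = Ng j))"


section \<open>Differential modules and their homology\<close>

text \<open>
  The twist \<open>D(a)\<close> has the same underlying module as \<open>D\<close>; only the grading differs.  In particular
  \<open>d(a)\<close> and \<open>d(-a)\<close> are the same function as \<open>d\<close>.
\<close>

locale differential_module = graded_module R Rg D Dg
  for R :: "('a, 'r) ring_scheme" (structure) and Rg :: "int \<Rightarrow> 'a set"
    and D :: "('a, 'b, 'm) module_scheme" (structure) and Dg :: "int \<Rightarrow> 'b set"
    and a :: int and d :: "'b \<Rightarrow> 'b" +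
  assumes differential_hom: "d \<in> graded_hom R D Dg D (shift_grading a Dg)"
    and differential_squared: "x \<in> carrier D \<Longrightarrow> d (d x) = \<zero>\<^bsub>D\<^esub>"

definition cycles :: "('a, 'b, 'm) module_scheme \<Rightarrow> ('b \<Rightarrow> 'b) \<Rightarrow> 'b set" where
  "cycles D d = {x \<in> carrier D. d x = \<zero>\<^bsub>D\<^esub>}"

definition boundaries :: "('a, 'b, 'm) module_scheme \<Rightarrow> ('b \<Rightarrow> 'b) \<Rightarrow> 'b set" where
  "boundaries D d = d ` carrier D"

definition homology :: "('a, 'b, 'm) module_scheme \<Rightarrow> ('b \<Rightarrow> 'b) \<Rightarrow> ('a, 'b set) module" where
  "homology D d = quotient_module (D\<lparr>carrier := cycles D d\<rparr>) (boundaries D d)"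

definition homology_grading :: "('a, 'b, 'm) module_scheme \<Rightarrow> (int \<Rightarrow> 'b set) \<Rightarrow> ('b \<Rightarrow> 'b) \<Rightarrow>
    int \<Rightarrow> 'b set set" where
  "homology_grading D Dg d =
    quotient_grading (D\<lparr>carrier := cycles D d\<rparr>) (boundaries D d) (\<lambda>j. cycles D d \<inter> Dg j)"


section \<open>The residue field as a graded module\<close>

definition irrelevant_ideal :: "nat \<Rightarrow> ('k::field) mpoly set" where
  "irrelevant_ideal n = genideal (polynomial_ring n) (variable ` {1..n})"

definition residue_module :: "nat \<Rightarrow> (('k::field) mpoly, 'k mpoly set) module" where
  "residue_module n = quotient_module (regular_module (polynomial_ring n)) (irrelevant_ideal n)"

definition residue_grading :: "nat \<Rightarrow> int \<Rightarrow> ('k::field) mpoly set set" where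
  "residue_grading n =
    quotient_grading (regular_module (polynomial_ring n)) (irrelevant_ideal n)
      (polynomial_grading n)"

end

theory Submission
  imports Defs "HOL-Library.Function_Algebras"
begin

text \<open>
  For \<open>n = 2\<close> take \<open>D = S(1)\<^sup>2\<close> with \<open>d w = (x\<^sub>2 w\<^sub>0 - x\<^sub>1 w\<^sub>1) z\<close>, where \<open>z = (x\<^sub>1, x\<^sub>2)\<close> has
  degree \<open>0\<close>: the cycles are \<open>S z\<close> and the boundaries \<open>(x\<^sub>1, x\<^sub>2) z\<close>.  For every further variable
  \<open>x\<close>, replace \<open>D\<close> by the cone \<open>D \<oplus> D(1)\<close> of multiplication by \<open>x\<close>, with differential
  \<open>(u, v) \<mapsto> (d u + x v, - d v)\<close>; this is again of degree \<open>2\<close> and doubles the rank.  The invariant is that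
  every cycle is a multiple of \<open>z\<close> up to a boundary, and that \<open>t z\<close> is a boundary exactly when
  \<open>t \<in> (x\<^sub>1, \<dots>, x\<^sub>m)\<close>; it survives the cone because \<open>x\<^sub>1, \<dots>, x\<^sub>n\<close> is a regular sequence.  Compatibility
  of \<open>d\<close> with the projections to homogeneous components makes the resulting isomorphism
  \<open>S/(x\<^sub>1, \<dots>, x\<^sub>n) \<cong> H(D)\<close>, \<open>t \<mapsto> t z\<close>, graded.
\<close>

section \<open>Polynomials with finitely supported exponent vectors\<close>

lemma polynomial_ring_simps [simp]:
  "mult (polynomial_ring n) = (*)" "one (polynomial_ring n) = 1"
  "zero (polynomial_ring n) = 0" "add (polynomial_ring n) = (+)"
  by (simp_all add: polynomial_ring_def)

lemma mem_polynomial_ring_iff: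
  "p \<in> carrier (polynomial_ring n) \<longleftrightarrow>
    (\<forall>a. Poly_Mapping.lookup p a \<noteq> 0 \<longrightarrow> Poly_Mapping.keys a \<subseteq> {1..n})"
  by (auto simp: polynomial_ring_def in_keys_iff)

lemma zero_polynomial [simp]: "0 \<in> carrier (polynomial_ring n)"
  by (simp add: mem_polynomial_ring_iff)

lemma one_polynomial [simp]: "1 \<in> carrier (polynomial_ring n)"
  by (simp add: polynomial_ring_def)

lemma add_polynomial [simp]:
  "p \<in> carrier (polynomial_ring n) \<Longrightarrow> q \<in> carrier (polynomial_ring n) \<Longrightarrow>
    p + q \<in> carrier (polynomial_ring n)"
  using keys_add[of p q] by (auto simp: polynomial_ring_def)

lemma uminus_polynomial [simp]:
  fixes p :: "('k::field) mpoly"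
  shows "p \<in> carrier (polynomial_ring n) \<Longrightarrow> - p \<in> carrier (polynomial_ring n)"
  by (simp add: mem_polynomial_ring_iff)

lemma diff_polynomial [simp]:
  fixes p :: "('k::field) mpoly"
  shows "p \<in> carrier (polynomial_ring n) \<Longrightarrow> q \<in> carrier (polynomial_ring n) \<Longrightarrow>
    p - q \<in> carrier (polynomial_ring n)"
  using add_polynomial[of p n "- q"] by simp

text \<open>Exponents are natural numbers, so nothing cancels when monomials are multiplied.
  Arguments on which variables occur in a product rest on this.\<close>

lemma keys_add_exponent:
  fixes a b :: "nat \<Rightarrow>\<^sub>0 nat"
  shows "Poly_Mapping.keys (a + b) = Poly_Mapping.keys a \<union> Poly_Mapping.keys b"
  by (auto simp: in_keys_iff lookup_add)

lemma mult_polynomial [simp]: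
  "p \<in> carrier (polynomial_ring n) \<Longrightarrow> q \<in> carrier (polynomial_ring n) \<Longrightarrow>
    p * q \<in> carrier (polynomial_ring n)"
  using keys_mult[of p q] by (fastforce simp: polynomial_ring_def keys_add_exponent)

lemma variable_polynomial [simp]:
  "i \<in> {1..n} \<Longrightarrow> variable i \<in> carrier (polynomial_ring n)"
  by (simp add: polynomial_ring_def variable_def)

lemma cring_polynomial_ring: "cring (polynomial_ring n :: ('k::field) mpoly ring)"
proof (intro cringI abelian_groupI comm_monoidI)
  fix p :: "'k mpoly"
  assume "p \<in> carrier (polynomial_ring n)"
  then show "\<exists>q\<in>carrier (polynomial_ring n).
      q \<oplus>\<^bsub>polynomial_ring n\<^esub> p = \<zero>\<^bsub>polynomial_ring n\<^esub>"
    by (intro bexI[of _ "- p"]) auto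
qed (auto simp: algebra_simps)

section \<open>Coefficients of multiples of a variable, and divisibility by a variable\<close>

lemma lookup_variable_mult_shift [simp]:
  "Poly_Mapping.lookup (variable i * p) (Poly_Mapping.single i 1 + a) = Poly_Mapping.lookup p a"
  by (simp add: lookup_mult variable_def lookup_single when_mult)

lemma lookup_variable_mult_notin:
  assumes "i \<notin> Poly_Mapping.keys a"
  shows "Poly_Mapping.lookup (variable i * p) a = 0"
proof (rule ccontr)
  assume "Poly_Mapping.lookup (variable i * p) a \<noteq> 0"
  then have "a \<in> Poly_Mapping.keys (variable i * p)"
    by (simp add: in_keys_iff)
  then obtain b where "a = Poly_Mapping.single i 1 + b"
    using keys_mult[of "variable i" p] by (auto simp: variable_def)
  with assms show False
    by (simp add: keys_add_exponent)
qed

lemma exponent_split: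
  fixes a :: "nat \<Rightarrow>\<^sub>0 nat"
  assumes "i \<in> Poly_Mapping.keys a"
  obtains b where "a = Poly_Mapping.single i 1 + b"
proof
  \<comment> \<open>The subtraction is truncated, but it only affects the exponent at
    \<open>i\<close>, which is positive.\<close>
  show "a = Poly_Mapping.single i 1 + (a - Poly_Mapping.single i 1)"
    using assms
    by (intro poly_mapping_eqI) (auto simp: lookup_add lookup_minus lookup_single in_keys_iff when_def)
qed

lemma variable_neq_zero [simp]: "variable i \<noteq> 0"
  using lookup_single_eq[of "Poly_Mapping.single i 1" "1"]
  by (metis lookup_zero variable_def zero_neq_one)

lemma divisible_by_variable:
  fixes p :: "('k::field) mpoly"
  assumes p: "p \<in> carrier (polynomial_ring n)"
    and i: "\<And>a. Poly_Mapping.lookup p a \<noteq> 0 \<Longrightarrow> i \<in> Poly_Mapping.keys a"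
  obtains q where "q \<in> carrier (polynomial_ring n)" "p = variable i * q"
proof
  let ?f = "\<lambda>a. Poly_Mapping.single i (1::nat) + a"
  \<comment> \<open>The quotient takes its coefficient at \<open>a\<close> from the coefficient of
    \<open>p\<close> at x_i times \<open>a\<close>; since this shift is injective,
    \<open>map_key\<close> keeps the support finite.\<close>
  let ?q = "Poly_Mapping.map_key ?f p"
  have lookup_q: "Poly_Mapping.lookup ?q a = Poly_Mapping.lookup p (?f a)" for a
    by (subst map_key.rep_eq) (auto simp: inj_on_def)
  show "?q \<in> carrier (polynomial_ring n)"
    unfolding mem_polynomial_ring_iff
  proof (intro allI impI)
    fix a
    assume "Poly_Mapping.lookup ?q a \<noteq> 0"
    then have "Poly_Mapping.keys (?f a) \<subseteq> {1..n}"
      using p unfolding lookup_q mem_polynomial_ring_iff by blast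
    then show "Poly_Mapping.keys a \<subseteq> {1..n}"
      by (simp add: keys_add_exponent)
  qed
  show "p = variable i * ?q"
  proof (rule poly_mapping_eqI)
    fix a
    show "Poly_Mapping.lookup p a = Poly_Mapping.lookup (variable i * ?q) a"
    proof (cases "i \<in> Poly_Mapping.keys a")
      case True
      then obtain b where a: "a = ?f b"
        by (rule exponent_split)
      show ?thesis
        unfolding a lookup_variable_mult_shift lookup_q ..
    next
      case False
      then show ?thesis
        using i lookup_variable_mult_notin by metis
    qed
  qed
qed

text \<open>Serves two purposes: a condition on the support splits a polynomial along an ideal
  generated by variables, and a condition on the degree yields its homogeneous components.\<close>

lift_definition monomial_part :: "('a \<Rightarrow> bool) \<Rightarrow> ('a \<Rightarrow>\<^sub>0 'b::zero) \<Rightarrow> 'a \<Rightarrow>\<^sub>0 'b"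
  is "\<lambda>Q p a. if Q a then p a else 0"
  by (erule rev_finite_subset) auto

lemma monomial_part_polynomial [simp]:
  "p \<in> carrier (polynomial_ring n) \<Longrightarrow> monomial_part Q p \<in> carrier (polynomial_ring n)"
  by (simp add: mem_polynomial_ring_iff monomial_part.rep_eq)

lemma monomial_part_add: "monomial_part Q (p + q) = monomial_part Q p + monomial_part Q q"
  by (rule poly_mapping_eqI) (simp add: monomial_part.rep_eq lookup_add)

lemma monomial_part_zero [simp]: "monomial_part Q 0 = 0"
  by (rule poly_mapping_eqI) (simp add: monomial_part.rep_eq)

lemma monomial_part_uminus:
  fixes p :: "'a \<Rightarrow>\<^sub>0 'b::ab_group_add"
  shows "monomial_part Q (- p) = - monomial_part Q p"
  by (rule poly_mapping_eqI) (simp add: monomial_part.rep_eq)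

lemma monomial_part_split: "p = monomial_part Q p + monomial_part (\<lambda>a. \<not> Q a) p"
  by (rule poly_mapping_eqI) (simp add: monomial_part.rep_eq lookup_add)

section \<open>The ideal generated by the first variables\<close>

text \<open>The ideal \<open>(x\<^sub>1, \<dots>, x\<^sub>m)\<close> is described by its monomials, so that membership and the regularity of
  the sequence of variables can be read off from coefficients.\<close>

definition first_variables_ideal :: "nat \<Rightarrow> nat \<Rightarrow> ('k::field) mpoly set" where
  "first_variables_ideal n m = {p \<in> carrier (polynomial_ring n).
     \<forall>a. Poly_Mapping.lookup p a \<noteq> 0 \<longrightarrow> Poly_Mapping.keys a \<inter> {1..m} \<noteq> {}}"

lemma first_variables_ideal_subset:
  "first_variables_ideal n m \<subseteq> carrier (polynomial_ring n)"
  by (auto simp: first_variables_ideal_def)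

lemma first_variables_ideal_zero_index: "first_variables_ideal n 0 = {0}"
  by (auto simp: first_variables_ideal_def intro!: poly_mapping_eqI)

lemma first_variables_ideal_zero [simp]: "0 \<in> first_variables_ideal n m"
  by (simp add: first_variables_ideal_def)

lemma first_variables_ideal_mono:
  "m \<le> l \<Longrightarrow> first_variables_ideal n m \<subseteq> first_variables_ideal n l"
  by (fastforce simp: first_variables_ideal_def)

lemma first_variables_ideal_add:
  "p \<in> first_variables_ideal n m \<Longrightarrow> q \<in> first_variables_ideal n m \<Longrightarrow>
    p + q \<in> first_variables_ideal n m"
  by (auto simp: first_variables_ideal_def lookup_add) (metis add.right_neutral)

lemma first_variables_ideal_uminus:
  "p \<in> first_variables_ideal n m \<Longrightarrow> - p \<in> first_variables_ideal n m"
  by (auto simp: first_variables_ideal_def)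

lemma first_variables_ideal_mult:
  assumes "p \<in> carrier (polynomial_ring n)" "q \<in> first_variables_ideal n m"
  shows "p * q \<in> first_variables_ideal n m"
proof -
  have "Poly_Mapping.keys a \<inter> {1..m} \<noteq> {}" if "Poly_Mapping.lookup (p * q) a \<noteq> 0" for a
  proof -
    from that have "a \<in> Poly_Mapping.keys (p * q)"
      by (simp add: in_keys_iff)
    then obtain b c where "a = b + c" "c \<in> Poly_Mapping.keys q"
      using keys_mult[of p q] by auto
    with assms(2) show ?thesis
      by (auto simp: first_variables_ideal_def keys_add_exponent in_keys_iff)
  qed
  with assms show ?thesis
    by (auto simp: first_variables_ideal_def)
qed

lemma variable_mem_first_variables_ideal:
  "i \<in> {1..m} \<Longrightarrow> m \<le> n \<Longrightarrow> variable i \<in> first_variables_ideal n m"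
  by (auto simp: first_variables_ideal_def variable_def lookup_single when_def
      mem_polynomial_ring_iff split: if_splits)

text \<open>This is the regularity of the sequence of variables. Multiplication by x_i shifts the
  monomials of \<open>p\<close> without cancellation and adds at most the index \<open>i\<close> to
  their supports, so an index from 1 to m must have been there before.\<close>

lemma first_variables_ideal_cancel_variable:
  assumes p: "p \<in> carrier (polynomial_ring n)"
    and xp: "variable i * p \<in> first_variables_ideal n m" and i: "i \<notin> {1..m}"
  shows "p \<in> first_variables_ideal n m"
proof -
  have "Poly_Mapping.keys a \<inter> {1..m} \<noteq> {}" if a: "Poly_Mapping.lookup p a \<noteq> 0" for a
  proof -
    have "Poly_Mapping.keys (Poly_Mapping.single i 1 + a) \<inter> {1..m} \<noteq> {}"
      using xp a lookup_variable_mult_shift[of i p a] unfolding first_variables_ideal_def by auto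
    then show ?thesis
      using i by (auto simp: keys_add_exponent)
  qed
  with p show ?thesis
    by (simp add: first_variables_ideal_def)
qed

lemma first_variables_ideal_Suc:
  assumes "Suc m \<le> n"
  shows "p \<in> first_variables_ideal n (Suc m) \<longleftrightarrow>
    (\<exists>q\<in>first_variables_ideal n m. \<exists>t\<in>carrier (polynomial_ring n). p = q + variable (Suc m) * t)"
proof
  assume p: "p \<in> first_variables_ideal n (Suc m)"
  \<comment> \<open>The monomials of \<open>p\<close> that involve one of the first m variables make
    up the summand in the smaller ideal. Every other monomial must involve the variable
    \<open>Suc m\<close>, which is factored out.\<close>
  let ?Q = "\<lambda>a. Poly_Mapping.keys a \<inter> {1..m} \<noteq> {}"
  have S: "p \<in> carrier (polynomial_ring n)"
    using p by (simp add: first_variables_ideal_def)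
  have "Suc m \<in> Poly_Mapping.keys a"
    if "Poly_Mapping.lookup (monomial_part (\<lambda>a. \<not> ?Q a) p) a \<noteq> 0" for a
    using p that
    by (auto simp: monomial_part.rep_eq first_variables_ideal_def atLeastAtMostSuc_conv split: if_splits)
  then obtain t where t: "t \<in> carrier (polynomial_ring n)"
    "monomial_part (\<lambda>a. \<not> ?Q a) p = variable (Suc m) * t"
    using divisible_by_variable[of "monomial_part (\<lambda>a. \<not> ?Q a) p" n "Suc m"] S
    by (metis (no_types, lifting) monomial_part_polynomial)
  have "monomial_part ?Q p \<in> first_variables_ideal n m"
    using S by (simp add: first_variables_ideal_def monomial_part.rep_eq)
  with t show "\<exists>q\<in>first_variables_ideal n m. \<exists>t\<in>carrier (polynomial_ring n).
      p = q + variable (Suc m) * t"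
    using monomial_part_split[of p ?Q] by metis
next
  assume "\<exists>q\<in>first_variables_ideal n m. \<exists>t\<in>carrier (polynomial_ring n).
      p = q + variable (Suc m) * t"
  then show "p \<in> first_variables_ideal n (Suc m)"
    using first_variables_ideal_mono[of m "Suc m" n] assms
      variable_mem_first_variables_ideal[of "Suc m" "Suc m" n]
    by (auto intro!: first_variables_ideal_add first_variables_ideal_mult simp: mult.commute[of "variable _"])
qed

lemma first_variables_ideal_one:
  "1 \<le> n \<Longrightarrow> p \<in> first_variables_ideal n 1 \<longleftrightarrow>
    (\<exists>t\<in>carrier (polynomial_ring n). p = variable 1 * t)"
  using first_variables_ideal_Suc[of 0 n p] by (auto simp: first_variables_ideal_zero_index)

lemma first_variables_ideal_ideal:
  "ideal (first_variables_ideal n m) (polynomial_ring n :: ('k::field) mpoly ring)"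
proof (rule idealI)
  show "ring (polynomial_ring n :: 'k mpoly ring)"
    by (rule cring.axioms(1)[OF cring_polynomial_ring])
  interpret cring "polynomial_ring n :: 'k mpoly ring"
    by (rule cring_polynomial_ring)
  show "subgroup (first_variables_ideal n m) (add_monoid (polynomial_ring n :: 'k mpoly ring))"
  proof (rule add.subgroupI)
    fix p :: "'k mpoly"
    assume p: "p \<in> first_variables_ideal n m"
    then have "\<ominus>\<^bsub>polynomial_ring n\<^esub> p = - p"
      by (intro minus_equality) (auto simp: first_variables_ideal_def)
    with p show "\<ominus>\<^bsub>polynomial_ring n\<^esub> p \<in> first_variables_ideal n m"
      by (simp add: first_variables_ideal_uminus)
  next
    show "first_variables_ideal n m \<noteq> ({} :: 'k mpoly set)"
      using first_variables_ideal_zero by blast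
  qed (use first_variables_ideal_subset in \<open>auto simp: first_variables_ideal_add\<close>)
qed (auto simp: first_variables_ideal_mult, metis first_variables_ideal_mult mult.commute)

lemma irrelevant_ideal_eq:
  "irrelevant_ideal n = (first_variables_ideal n n :: ('k::field) mpoly set)"
proof
  interpret cring "polynomial_ring n :: 'k mpoly ring"
    by (rule cring_polynomial_ring)
  show "irrelevant_ideal n \<subseteq> (first_variables_ideal n n :: 'k mpoly set)"
    unfolding irrelevant_ideal_def
    by (rule genideal_minimal[OF first_variables_ideal_ideal])
      (auto simp: variable_mem_first_variables_ideal)
  have sub: "variable ` {1..n} \<subseteq> carrier (polynomial_ring n :: 'k mpoly ring)"
    by auto
  interpret J: ideal "irrelevant_ideal n :: 'k mpoly set" "polynomial_ring n"
    unfolding irrelevant_ideal_def by (rule genideal_ideal[OF sub])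
  have gen: "variable i \<in> (irrelevant_ideal n :: 'k mpoly set)" if "i \<in> {1..n}" for i
    using genideal_self[OF sub] that by (auto simp: irrelevant_ideal_def)
  \<comment> \<open>Stated for every m \<le> n, so that the induction can bring in one generator at
    a time.\<close>
  have "first_variables_ideal n m \<subseteq> (irrelevant_ideal n :: 'k mpoly set)" if "m \<le> n" for m
    using that
  proof (induction m)
    case 0
    then show ?case
      using J.zero_closed by (simp add: first_variables_ideal_zero_index)
  next
    case (Suc m)
    show ?case
    proof
      fix p :: "'k mpoly"
      assume "p \<in> first_variables_ideal n (Suc m)"
      then obtain q t where "q \<in> first_variables_ideal n m" "t \<in> carrier (polynomial_ring n)"
        "p = q + variable (Suc m) * t"
        using Suc.prems by (auto simp: first_variables_ideal_Suc)
      then show "p \<in> irrelevant_ideal n"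
        using Suc J.a_closed[of q "variable (Suc m) * t"] J.I_r_closed[OF gen, of "Suc m" t]
        by auto
    qed
  qed
  then show "first_variables_ideal n n \<subseteq> (irrelevant_ideal n :: 'k mpoly set)"
    by simp
qed

section \<open>Homogeneous components\<close>

text \<open>Degrees are integers, so that shifts in either direction need no side condition;
  components of negative degree are 0.\<close>

definition homogeneous_part :: "int \<Rightarrow> ('k::field) mpoly \<Rightarrow> 'k mpoly" where
  "homogeneous_part j = monomial_part (\<lambda>a. int (monomial_degree a) = j)"

lemma lookup_homogeneous_part:
  "Poly_Mapping.lookup (homogeneous_part j p) a =
    (if int (monomial_degree a) = j then Poly_Mapping.lookup p a else 0)"
  by (simp add: homogeneous_part_def monomial_part.rep_eq)

lemma homogeneous_part_zero [simp]: "homogeneous_part j 0 = 0"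
  by (simp add: homogeneous_part_def)

lemma homogeneous_part_add: "homogeneous_part j (p + q) = homogeneous_part j p + homogeneous_part j q"
  by (simp add: homogeneous_part_def monomial_part_add)

lemma homogeneous_part_uminus: "homogeneous_part j (- p) = - homogeneous_part j p"
  by (simp add: homogeneous_part_def monomial_part_uminus)

lemma homogeneous_part_diff: "homogeneous_part j (p - q) = homogeneous_part j p - homogeneous_part j q"
  using homogeneous_part_add[of j p "- q"] by (simp add: homogeneous_part_uminus)

lemma homogeneous_part_polynomial [simp]:
  "p \<in> carrier (polynomial_ring n) \<Longrightarrow> homogeneous_part j p \<in> carrier (polynomial_ring n)"
  by (simp add: homogeneous_part_def)

lemma mem_polynomial_grading_iff:
  "p \<in> polynomial_grading n j \<longleftrightarrow> p \<in> carrier (polynomial_ring n) \<and> homogeneous_part j p = p"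
  by (auto simp: polynomial_grading_def poly_mapping_eq_iff fun_eq_iff lookup_homogeneous_part
      in_keys_iff split: if_splits)

lemma homogeneous_part_homogeneous_part:
  "homogeneous_part i (homogeneous_part j p) = (if i = j then homogeneous_part j p else 0)"
  by (intro poly_mapping_eqI) (simp add: lookup_homogeneous_part)

lemma monomial_degree_add: "monomial_degree (a + b) = monomial_degree a + monomial_degree b"
proof -
  have *: "monomial_degree c = (\<Sum>i\<in>Poly_Mapping.keys a \<union> Poly_Mapping.keys b. Poly_Mapping.lookup c i)"
    if "Poly_Mapping.keys c \<subseteq> Poly_Mapping.keys a \<union> Poly_Mapping.keys b" for c
    unfolding monomial_degree_def using that by (intro sum.mono_neutral_left) (auto simp: in_keys_iff)
  show ?thesis
    by (simp add: * keys_add_exponent lookup_add sum.distrib)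
qed

text \<open>At monomials without x_i both coefficients vanish; at the others both are the same
  coefficient of \<open>p\<close>, under equivalent degree conditions. The differentials are built
  from variables, so this controls their degrees.\<close>

lemma homogeneous_part_variable_mult:
  "homogeneous_part j (variable i * p) = variable i * homogeneous_part (j - 1) p"
proof (rule poly_mapping_eqI)
  fix a
  show "Poly_Mapping.lookup (homogeneous_part j (variable i * p)) a =
    Poly_Mapping.lookup (variable i * homogeneous_part (j - 1) p) a"
  proof (cases "i \<in> Poly_Mapping.keys a")
    case True
    then obtain b where a: "a = Poly_Mapping.single i 1 + b"
      by (rule exponent_split)
    have "monomial_degree (Poly_Mapping.single i 1) = 1"
      by (simp add: monomial_degree_def)
    then show ?thesis
      unfolding lookup_homogeneous_part a lookup_variable_mult_shift by (auto simp: monomial_degree_add)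
  qed (simp add: lookup_homogeneous_part lookup_variable_mult_notin)
qed

lemma homogeneous_part_mult_variable:
  "homogeneous_part j (p * variable i) = homogeneous_part (j - 1) p * variable i"
  using homogeneous_part_variable_mult[of j i p] by (simp only: mult.commute)

lemma polynomial_grading_mult:
  assumes "p \<in> polynomial_grading n i" "q \<in> polynomial_grading n j"
  shows "p * q \<in> polynomial_grading n (i + j)"
  using assms keys_mult[of p q]
  by (fastforce simp: polynomial_grading_def monomial_degree_add)

lemma finite_homogeneous_parts: "finite {j. homogeneous_part j p \<noteq> 0}"
proof (rule finite_subset)
  show "{j. homogeneous_part j p \<noteq> 0} \<subseteq> (\<lambda>a. int (monomial_degree a)) ` Poly_Mapping.keys p"
    by (auto simp: poly_mapping_eq_iff fun_eq_iff lookup_homogeneous_part in_keys_iff split: if_splits)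
qed simp

text \<open>The index set may exceed the set of degrees with nonzero component: for a vector, one
  set of degrees has to serve all coordinates at once.\<close>

lemma sum_homogeneous_parts:
  assumes "finite J" "{j. homogeneous_part j p \<noteq> 0} \<subseteq> J"
  shows "(\<Sum>j\<in>J. homogeneous_part j p) = p"
proof (rule poly_mapping_eqI)
  fix a
  have "int (monomial_degree a) \<in> J" if "Poly_Mapping.lookup p a \<noteq> 0"
    using assms(2) that lookup_homogeneous_part[of "int (monomial_degree a)" p a] by force
  then show "Poly_Mapping.lookup (\<Sum>j\<in>J. homogeneous_part j p) a = Poly_Mapping.lookup p a"
    using assms(1) by (auto simp: lookup_sum lookup_homogeneous_part)
qed

lemma homogeneous_part_sum: "homogeneous_part j (sum f A) = (\<Sum>i\<in>A. homogeneous_part j (f i))"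
  by (induction A rule: infinite_finite_induct) (auto simp: homogeneous_part_add)

section \<open>Free modules as spaces of vectors\<close>

text \<open>Functions on \<open>nat\<close> that vanish from \<open>r\<close> on give all ranks the
  same type, so that the rank can double in an induction, and the module operations become the
  pointwise ones.\<close>

definition vectors :: "nat \<Rightarrow> nat \<Rightarrow> (nat \<Rightarrow> ('k::field) mpoly) set" where
  "vectors n r = {w. (\<forall>i. w i \<in> carrier (polynomial_ring n)) \<and> (\<forall>i\<ge>r. w i = 0)}"

definition scale :: "('k::field) mpoly \<Rightarrow> (nat \<Rightarrow> 'k mpoly) \<Rightarrow> nat \<Rightarrow> 'k mpoly" where
  "scale p w = (\<lambda>i. p * w i)"

definition vector_module :: "nat \<Rightarrow> nat \<Rightarrow> (('k::field) mpoly, nat \<Rightarrow> 'k mpoly) module" where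
  "vector_module n r =
    \<lparr>carrier = vectors n r, monoid.mult = undefined, one = undefined,
     ring.zero = 0, add = (+), smult = scale\<rparr>"

lemma vector_module_simps [simp]:
  "carrier (vector_module n r) = vectors n r" "zero (vector_module n r) = 0"
  "add (vector_module n r) = (+)" "smult (vector_module n r) = scale"
  by (simp_all add: vector_module_def)

lemma scale_apply [simp]: "scale p w i = p * w i"
  by (simp add: scale_def)

lemma scale_add_left: "scale (p + q) w = scale p w + scale q w"
  and scale_add_right: "scale p (v + w) = scale p v + scale p w"
  and scale_uminus_right: "scale p (- w) = - scale p w"
  and scale_diff_left: "scale (p - q) w = scale p w - scale q w"
  and scale_scale: "scale p (scale q w) = scale (p * q) w"
  by (auto simp: fun_eq_iff algebra_simps)

lemma scale_zero_right [simp]: "scale p 0 = 0"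
  by (simp add: fun_eq_iff)

lemma vectors_zero [simp]: "0 \<in> vectors n r"
  by (simp add: vectors_def)

lemma vectors_add [simp]: "v \<in> vectors n r \<Longrightarrow> w \<in> vectors n r \<Longrightarrow> v + w \<in> vectors n r"
  by (simp add: vectors_def)

lemma vectors_uminus [simp]: "w \<in> vectors n r \<Longrightarrow> - w \<in> vectors n r"
  by (simp add: vectors_def)

lemma vectors_diff [simp]: "v \<in> vectors n r \<Longrightarrow> w \<in> vectors n r \<Longrightarrow> v - w \<in> vectors n r"
  by (simp add: vectors_def)

lemma vectors_scale [simp]:
  "p \<in> carrier (polynomial_ring n) \<Longrightarrow> w \<in> vectors n r \<Longrightarrow> scale p w \<in> vectors n r"
  by (simp add: vectors_def)

lemma sum_fun_apply: "(sum f A) i = (\<Sum>a\<in>A. f a i)"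
  by (induction A rule: infinite_finite_induct) auto

lemma module_vector_module:
  "module (polynomial_ring n) (vector_module n r :: (('k::field) mpoly, _) module)"
proof (intro moduleI cring_polynomial_ring abelian_groupI)
  fix w :: "nat \<Rightarrow> 'k mpoly"
  assume "w \<in> carrier (vector_module n r)"
  then show "\<exists>v\<in>carrier (vector_module n r). v \<oplus>\<^bsub>vector_module n r\<^esub> w = \<zero>\<^bsub>vector_module n r\<^esub>"
    by (intro bexI[of _ "- w"]) auto
qed (auto simp: fun_eq_iff algebra_simps)

lemma finsum_vector_module:
  fixes f :: "'b \<Rightarrow> nat \<Rightarrow> ('k::field) mpoly"
  assumes "\<And>a. a \<in> A \<Longrightarrow> f a \<in> vectors n r"
  shows "finsum (vector_module n r) f A = sum f A"
proof -
  interpret module "polynomial_ring n" "vector_module n r :: ('k mpoly, _) module"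
    by (rule module_vector_module)
  show ?thesis
    using assms
    by (induction A rule: infinite_finite_induct) (auto simp: M.finsum_infinite M.finsum_insert Pi_def)
qed

definition unit_vector :: "nat \<Rightarrow> nat \<Rightarrow> ('k::field) mpoly" where
  "unit_vector i = (\<lambda>j. if j = i then 1 else 0)"

lemma inj_unit_vector: "inj unit_vector"
  by (auto simp: inj_on_def unit_vector_def fun_eq_iff split: if_splits)

lemma unit_vector_mem [simp]: "i < r \<Longrightarrow> unit_vector i \<in> vectors n r"
  by (simp add: vectors_def unit_vector_def)

lemma free_of_rank_vector_module:
  "free_of_rank (polynomial_ring n) (vector_module n r :: (('k::field) mpoly, _) module) r"
proof -
  let ?e = "unit_vector :: nat \<Rightarrow> nat \<Rightarrow> 'k mpoly"
  let ?B = "?e ` {..<r}"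
  let ?S = "carrier (polynomial_ring n) :: 'k mpoly set"
  have inj: "inj_on ?e A" for A
    by (rule inj_on_subset[OF inj_unit_vector]) simp
  \<comment> \<open>The coordinates of a combination of unit vectors are its coefficients; existence
    and uniqueness both follow by comparing coordinates.\<close>
  have combination: "(\<Oplus>\<^bsub>vector_module n r\<^esub>b\<in>?B. c b \<odot>\<^bsub>vector_module n r\<^esub> b) =
      (\<lambda>j. if j < r then c (?e j) else 0)" if "c \<in> ?B \<rightarrow>\<^sub>E ?S" for c :: "(nat \<Rightarrow> 'k mpoly) \<Rightarrow> 'k mpoly"
  proof -
    have "c (?e i) \<in> ?S" if "i < r" for i
      using PiE_mem[OF \<open>c \<in> ?B \<rightarrow>\<^sub>E ?S\<close>] that by simp
    then have "(\<Oplus>\<^bsub>vector_module n r\<^esub>b\<in>?B. c b \<odot>\<^bsub>vector_module n r\<^esub> b) = (\<Sum>b\<in>?B. scale (c b) b)"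
      by (subst finsum_vector_module) auto
    also have "\<dots> = (\<Sum>i<r. scale (c (?e i)) (?e i))"
      by (simp add: sum.reindex[OF inj])
    also have "\<dots> = (\<lambda>j. if j < r then c (?e j) else 0)"
      by (simp add: fun_eq_iff sum_fun_apply unit_vector_def if_distrib cong: if_cong)
    finally show ?thesis .
  qed
  have "\<exists>!c. c \<in> ?B \<rightarrow>\<^sub>E ?S \<and> x = (\<Oplus>\<^bsub>vector_module n r\<^esub>b\<in>?B. c b \<odot>\<^bsub>vector_module n r\<^esub> b)"
    if x: "x \<in> vectors n r" for x
  proof (rule ex1I)
    \<comment> \<open>The restriction to \<open>?B\<close> makes \<open>c\<close> extensional, and
      \<open>inv_into\<close> recovers the index of a unit vector.\<close>
    define c where "c = (\<lambda>b\<in>?B. x (inv_into {..<r} ?e b))"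
    have c: "c (?e i) = x i" if "i < r" for i
      using that by (simp add: c_def inv_into_f_f[OF inj])
    have "c \<in> ?B \<rightarrow>\<^sub>E ?S"
    proof (rule PiE_I)
      fix b assume "b \<in> ?B"
      then show "c b \<in> ?S"
        using x by (auto simp: c vectors_def)
    qed (simp add: c_def)
    then show c': "c \<in> ?B \<rightarrow>\<^sub>E ?S \<and> x = (\<Oplus>\<^bsub>vector_module n r\<^esub>b\<in>?B. c b \<odot>\<^bsub>vector_module n r\<^esub> b)"
      using x unfolding combination[OF \<open>c \<in> ?B \<rightarrow>\<^sub>E ?S\<close>] by (auto simp: c vectors_def fun_eq_iff)
    fix c'
    assume "c' \<in> ?B \<rightarrow>\<^sub>E ?S \<and> x = (\<Oplus>\<^bsub>vector_module n r\<^esub>b\<in>?B. c' b \<odot>\<^bsub>vector_module n r\<^esub> b)"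
    then have c'_mem: "c' \<in> ?B \<rightarrow>\<^sub>E ?S" and x_eq: "x = (\<lambda>j. if j < r then c' (?e j) else 0)"
      using combination by auto
    show "c' = c"
    proof (rule PiE_ext[OF c'_mem])
      show "c \<in> ?B \<rightarrow>\<^sub>E ?S" using c' by blast
      fix b assume "b \<in> ?B"
      then show "c' b = c b"
        by (auto simp: c) (simp add: x_eq)
    qed
  qed
  then have "basis (polynomial_ring n) (vector_module n r) ?B"
    by (auto simp: basis_def)
  moreover have "card ?B = r"
    by (simp add: card_image[OF inj])
  ultimately show ?thesis
    unfolding free_of_rank_def by blast
qed

section \<open>Gradings of free modules\<close>

text \<open>The basis vector with index \<open>i\<close> sits in degree \<open>- c i\<close>.\<close>

definition vector_part :: "(nat \<Rightarrow> nat) \<Rightarrow> int \<Rightarrow> (nat \<Rightarrow> ('k::field) mpoly) \<Rightarrow> nat \<Rightarrow> 'k mpoly" where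
  "vector_part c j w = (\<lambda>i. homogeneous_part (j + int (c i)) (w i))"

definition vector_grading :: "nat \<Rightarrow> nat \<Rightarrow> (nat \<Rightarrow> nat) \<Rightarrow> int \<Rightarrow> (nat \<Rightarrow> ('k::field) mpoly) set" where
  "vector_grading n r c j = {w \<in> vectors n r. vector_part c j w = w}"

lemma vector_part_apply [simp]: "vector_part c j w i = homogeneous_part (j + int (c i)) (w i)"
  by (simp add: vector_part_def)

lemma vector_part_add: "vector_part c j (v + w) = vector_part c j v + vector_part c j w"
  by (simp add: fun_eq_iff homogeneous_part_add)

lemma vector_part_uminus: "vector_part c j (- w) = - vector_part c j w"
  by (simp add: fun_eq_iff homogeneous_part_uminus)

lemma vector_part_scale_variable:
  "vector_part c (j + 1) (scale (variable i) w) = scale (variable i) (vector_part c j w)"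
proof -
  have "j + 1 + int (c l) - 1 = j + int (c l)" for l
    by simp
  then show ?thesis
    by (simp only: fun_eq_iff vector_part_apply scale_apply homogeneous_part_variable_mult) simp
qed

lemma vector_part_zero [simp]: "vector_part c j 0 = 0"
  by (simp add: fun_eq_iff)

lemma vector_part_vectors [simp]: "w \<in> vectors n r \<Longrightarrow> vector_part c j w \<in> vectors n r"
  by (simp add: vectors_def)

lemma vector_part_sum: "vector_part c j (sum f A) = (\<Sum>a\<in>A. vector_part c j (f a))"
  by (simp add: fun_eq_iff sum_fun_apply homogeneous_part_sum)

text \<open>The projections are orthogonal idempotents. On vectors, the fixed points of one, which
  form \<open>vector_grading\<close>, are therefore its image.\<close>

lemma vector_part_vector_part:
  "vector_part c i (vector_part c j w) = (if i = j then vector_part c j w else 0)"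
  by (simp add: fun_eq_iff homogeneous_part_homogeneous_part)

lemma vector_part_grading: "w \<in> vectors n r \<Longrightarrow> vector_part c j w \<in> vector_grading n r c j"
  by (simp add: vector_grading_def vector_part_vector_part)

lemma finite_vector_parts:
  assumes "w \<in> vectors n r"
  shows "finite {j. vector_part c j w \<noteq> 0}"
proof (rule finite_subset)
  \<comment> \<open>Each coordinate contributes the degrees of its homogeneous components, moved by
    its weight, and only finitely many coordinates are nonzero.\<close>
  show "{j. vector_part c j w \<noteq> 0} \<subseteq>
    (\<Union>i<r. (\<lambda>j. j - int (c i)) ` {j. homogeneous_part j (w i) \<noteq> 0})"
  proof
    fix j assume "j \<in> {j. vector_part c j w \<noteq> 0}"
    then obtain i where i: "homogeneous_part (j + int (c i)) (w i) \<noteq> 0"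
      by (auto simp: fun_eq_iff)
    with assms have "i < r"
      by (metis (mono_tags, lifting) homogeneous_part_zero leI mem_Collect_eq vectors_def)
    with i show "j \<in> (\<Union>i<r. (\<lambda>j. j - int (c i)) ` {j. homogeneous_part j (w i) \<noteq> 0})"
      by (auto intro!: bexI[of _ i] image_eqI[of _ _ "j + int (c i)"])
  qed
qed (simp add: finite_homogeneous_parts)

lemma sum_vector_parts:
  assumes "finite J" "{j. vector_part c j w \<noteq> 0} \<subseteq> J"
  shows "(\<Sum>j\<in>J. vector_part c j w) = w"
proof
  fix i
  have "{j. homogeneous_part j (w i) \<noteq> 0} \<subseteq> (\<lambda>j. j + int (c i)) ` J"
  proof
    fix j assume "j \<in> {j. homogeneous_part j (w i) \<noteq> 0}"
    then have "vector_part c (j - int (c i)) w i \<noteq> 0"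
      by simp
    then have "vector_part c (j - int (c i)) w \<noteq> 0"
      by (metis zero_fun_apply)
    then show "j \<in> (\<lambda>j. j + int (c i)) ` J"
      using assms(2) by (intro image_eqI[of _ _ "j - int (c i)"]) auto
  qed
  then have "(\<Sum>j\<in>(\<lambda>j. j + int (c i)) ` J. homogeneous_part j (w i)) = w i"
    using assms(1) by (intro sum_homogeneous_parts) auto
  then show "(\<Sum>j\<in>J. vector_part c j w) i = w i"
    by (simp add: sum_fun_apply sum.reindex inj_on_def)
qed

lemma graded_module_vector_module:
  "graded_module (polynomial_ring n) (polynomial_grading n)
    (vector_module n r :: (('k::field) mpoly, _) module) (vector_grading n r c)"
proof -
  let ?M = "vector_module n r :: ('k mpoly, _) module"
  interpret module "polynomial_ring n" ?M
    by (rule module_vector_module)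
  show ?thesis
  proof (intro graded_module.intro graded_module_axioms.intro module_vector_module)
    fix j
    show "additive_subgroup (vector_grading n r c j) ?M"
    proof (intro additive_subgroup.intro M.add.subgroupI)
      have "0 \<in> vector_grading n r c j"
        by (simp add: vector_grading_def)
      then show "vector_grading n r c j \<noteq> ({} :: (nat \<Rightarrow> 'k mpoly) set)"
        by blast
      fix w :: "nat \<Rightarrow> 'k mpoly"
      assume w: "w \<in> vector_grading n r c j"
      then have "\<ominus>\<^bsub>?M\<^esub> w = - w"
        by (intro M.minus_equality) (auto simp: vector_grading_def)
      with w show "\<ominus>\<^bsub>?M\<^esub> w \<in> vector_grading n r c j"
        by (simp add: vector_grading_def vector_part_uminus)
    qed (auto simp: vector_grading_def vector_part_add)
  next
    fix x :: "nat \<Rightarrow> 'k mpoly"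
    assume "x \<in> carrier ?M"
    then have x: "x \<in> vectors n r"
      by simp
    show "\<exists>!f. (\<forall>j. f j \<in> vector_grading n r c j) \<and> finite {j. f j \<noteq> \<zero>\<^bsub>?M\<^esub>} \<and>
        x = (\<Oplus>\<^bsub>?M\<^esub>j\<in>{j. f j \<noteq> \<zero>\<^bsub>?M\<^esub>}. f j)"
    proof (rule ex1I)
      show "(\<forall>j. vector_part c j x \<in> vector_grading n r c j) \<and>
          finite {j. vector_part c j x \<noteq> \<zero>\<^bsub>?M\<^esub>} \<and>
          x = (\<Oplus>\<^bsub>?M\<^esub>j\<in>{j. vector_part c j x \<noteq> \<zero>\<^bsub>?M\<^esub>}. vector_part c j x)"
        using x finite_vector_parts[OF x, of c]
        by (simp add: vector_part_grading finsum_vector_module sum_vector_parts)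
    next
      fix f
      assume f: "(\<forall>j. f j \<in> vector_grading n r c j) \<and> finite {j. f j \<noteq> \<zero>\<^bsub>?M\<^esub>} \<and>
        x = (\<Oplus>\<^bsub>?M\<^esub>j\<in>{j. f j \<noteq> \<zero>\<^bsub>?M\<^esub>}. f j)"
      have f_vectors: "f j \<in> vectors n r" for j
        using f by (auto simp: vector_grading_def)
      have f_part: "vector_part c i (f j) = (if i = j then f j else 0)" for i j
        using f vector_part_vector_part[of c i j "f j"] by (auto simp: vector_grading_def)
      have "x = (\<Sum>j\<in>{j. f j \<noteq> 0}. f j)"
        using f by (simp add: finsum_vector_module f_vectors)
      \<comment> \<open>Projecting the given decomposition to degree \<open>i\<close> leaves only
        the summand \<open>f i\<close>, whence uniqueness.\<close>
      then have "vector_part c i x = (\<Sum>j\<in>{j. f j \<noteq> 0}. if i = j then f j else 0)" for i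
        by (simp add: vector_part_sum f_part)
      then show "f = (\<lambda>j. vector_part c j x)"
        using f by (simp add: fun_eq_iff)
    qed
  next
    fix p :: "'k mpoly" and x :: "nat \<Rightarrow> 'k mpoly" and i j
    assume "p \<in> polynomial_grading n i" "x \<in> vector_grading n r c j"
    then have "p * x l \<in> polynomial_grading n (i + (j + int (c l)))" for l
      by (intro polynomial_grading_mult)
        (auto simp: vector_grading_def vectors_def fun_eq_iff mem_polynomial_grading_iff)
    with \<open>x \<in> vector_grading n r c j\<close> show "p \<odot>\<^bsub>?M\<^esub> x \<in> vector_grading n r c (i + j)"
      by (auto simp: vector_grading_def vectors_def fun_eq_iff mem_polynomial_grading_iff add.assoc)
  qed
qed

section \<open>The folded Koszul complex\<close>

text \<open>Up to the choice of a basis of \<open>K\<^sub>1\<close>, this is the image of the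
  generator of \<open>K\<^sub>2\<close> under the Koszul differential on the first two
  variables.\<close>

definition fundamental_cycle :: "nat \<Rightarrow> ('k::field) mpoly" where
  "fundamental_cycle = (\<lambda>i. if i = 0 then variable 1 else if i = 1 then variable 2 else 0)"

lemma fundamental_cycle_mem [simp]: "2 \<le> n \<Longrightarrow> 2 \<le> r \<Longrightarrow> fundamental_cycle \<in> vectors n r"
  by (auto simp: vectors_def fundamental_cycle_def)

text \<open>The induction hypothesis. The ring keeps all n variables, while only the first m have
  entered the differential. Linearity is asked of all functions, so it applies without membership
  conditions. Commutation with the projections, in \<open>part\<close>, is what later turns a
  decomposition of a homogeneous cycle into a homogeneous one. The assumptions from
  \<open>cycle\<close> on say that sending t to the class of t z is well defined and onto the
  homology, with kernel (x_1, ..., x_m).\<close>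

locale folded_koszul =
  fixes n m r :: nat and c :: "nat \<Rightarrow> nat"
    and d :: "(nat \<Rightarrow> ('k::field) mpoly) \<Rightarrow> nat \<Rightarrow> 'k mpoly"
  assumes bounds: "2 \<le> m" "m \<le> n" "2 \<le> r"
    and weights: "c 0 = 1" "c 1 = 1"
    and closed: "w \<in> vectors n r \<Longrightarrow> d w \<in> vectors n r"
    and add: "d (v + w) = d v + d w"
    and scale: "d (scale p w) = scale p (d w)"
    and square: "w \<in> vectors n r \<Longrightarrow> d (d w) = 0"
    and part: "w \<in> vectors n r \<Longrightarrow> d (vector_part c j w) = vector_part c (j + 2) (d w)"
    and cycle: "d fundamental_cycle = 0"
    and cycle_decomposition: "w \<in> vectors n r \<Longrightarrow> d w = 0 \<Longrightarrow>
      \<exists>t\<in>carrier (polynomial_ring n). \<exists>y\<in>vectors n r. w = scale t fundamental_cycle + d y"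
    and boundary_iff: "t \<in> carrier (polynomial_ring n) \<Longrightarrow>
      scale t fundamental_cycle \<in> d ` vectors n r \<longleftrightarrow> t \<in> first_variables_ideal n m"
begin

lemma uminus: "d (- w) = - d w"
proof -
  have *: "- v = scale (- 1) v" for v :: "nat \<Rightarrow> 'k mpoly"
    by (simp add: fun_eq_iff)
  show ?thesis
    unfolding *[of w] *[of "d w"] by (rule scale)
qed

lemma diff: "d (v - w) = d v - d w"
  using add[of v "- w"] by (simp add: uminus)

lemma zero: "d 0 = 0"
  using diff[of 0 0] by simp

end

subsection \<open>Two variables\<close>

text \<open>The composite \<open>K\<^sub>1 \<rightarrow> K\<^sub>0 = S = K\<^sub>2 \<rightarrow> K\<^sub>1\<close> of the differentials of the Koszul complex
  on \<open>x\<^sub>1, x\<^sub>2\<close>.\<close>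

definition two_variable_differential :: "(nat \<Rightarrow> ('k::field) mpoly) \<Rightarrow> nat \<Rightarrow> 'k mpoly" where
  "two_variable_differential w = scale (variable 2 * w 0 - variable 1 * w 1) fundamental_cycle"

lemma two_variables_ideal_iff:
  fixes t :: "('k::field) mpoly"
  assumes "2 \<le> n"
  shows "t \<in> first_variables_ideal n 2 \<longleftrightarrow>
    (\<exists>p\<in>carrier (polynomial_ring n). \<exists>q\<in>carrier (polynomial_ring n). t = variable 1 * p + variable 2 * q)"
proof -
  have *: "1 \<le> n"
    using assms by simp
  have "t \<in> first_variables_ideal n (Suc (Suc 0)) \<longleftrightarrow>
    (\<exists>p\<in>carrier (polynomial_ring n). \<exists>q\<in>carrier (polynomial_ring n). t = variable 1 * p + variable 2 * q)"
    using first_variables_ideal_Suc[of "Suc 0" n t] assms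
    unfolding numeral_2_eq_2 Bex_def One_nat_def
      first_variables_ideal_one[OF *, unfolded Bex_def One_nat_def]
    by blast
  then show ?thesis
    by (simp add: numeral_2_eq_2)
qed

text \<open>Exactness of the Koszul complex at \<open>K\<^sub>1\<close>: x_2 is a nonzerodivisor
  modulo x_1, so x_1 divides \<open>p\<close>, and cancelling x_1 from the equation determines
  \<open>q\<close>.\<close>

lemma two_variable_syzygy:
  fixes p q :: "('k::field) mpoly"
  assumes n: "2 \<le> n" and p: "p \<in> carrier (polynomial_ring n)"
    and q: "q \<in> carrier (polynomial_ring n)" and eq: "variable 2 * p = variable 1 * q"
  obtains t where "t \<in> carrier (polynomial_ring n)" "p = variable 1 * t" "q = variable 2 * t"
proof -
  have "1 \<le> n"
    using n by simp
  note one = first_variables_ideal_one[OF this]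
  have "variable 2 * p \<in> first_variables_ideal n 1"
    unfolding eq one using q by blast
  then have "p \<in> first_variables_ideal n 1"
    by (rule first_variables_ideal_cancel_variable[OF p]) simp
  then obtain t where t: "t \<in> carrier (polynomial_ring n)" "p = variable 1 * t"
    unfolding one by blast
  have "variable 1 * q = variable 1 * (variable 2 * t)"
    using eq unfolding t(2) by (simp only: mult.left_commute)
  then have "q = variable 2 * t"
    by (simp add: mult_left_cancel)
  with t that show thesis
    by blast
qed

text \<open>In coordinate 0 the factor x_1 can be cancelled, so z generates a free submodule of rank
  one.\<close>

lemma scale_fundamental_cycle_eq_iff:
  "scale s fundamental_cycle = scale t fundamental_cycle \<longleftrightarrow> s = t"
  by (auto simp: fun_eq_iff fundamental_cycle_def dest: spec[of _ 0])

lemma scale_fundamental_cycle_eq_zero: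
  "scale t fundamental_cycle = 0 \<longleftrightarrow> t = 0"
  by (auto simp: fun_eq_iff fundamental_cycle_def dest: spec[of _ 0])

lemma folded_koszul_two:
  assumes n: "2 \<le> n"
  shows "folded_koszul n 2 2 (\<lambda>_. 1) (two_variable_differential :: (nat \<Rightarrow> ('k::field) mpoly) \<Rightarrow> _)"
proof
  fix w :: "nat \<Rightarrow> 'k mpoly" and j
  \<comment> \<open>The scalar factor and the vector z raise the degree by one each.\<close>
  show "two_variable_differential (vector_part (\<lambda>_. 1) j w) =
      vector_part (\<lambda>_. 1) (j + 2) (two_variable_differential w)"
    by (auto simp: two_variable_differential_def fundamental_cycle_def fun_eq_iff
        add.commute[of 1 j] homogeneous_part_variable_mult homogeneous_part_mult_variable
        homogeneous_part_diff)
next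
  fix w :: "nat \<Rightarrow> 'k mpoly"
  assume w: "w \<in> vectors n 2" "two_variable_differential w = 0"
  then have "variable 2 * w 0 = variable 1 * w 1"
    by (simp add: two_variable_differential_def scale_fundamental_cycle_eq_zero)
  then obtain t where t: "t \<in> carrier (polynomial_ring n)" "w 0 = variable 1 * t" "w 1 = variable 2 * t"
    using two_variable_syzygy[OF n, of "w 0" "w 1"] w(1) by (auto simp: vectors_def)
  \<comment> \<open>The boundary term is 0, since here every cycle is itself a multiple of
    z.\<close>
  have "w = scale t fundamental_cycle + two_variable_differential 0"
  proof
    fix i :: nat
    consider "i = 0" | "i = 1" | "2 \<le> i" by linarith
    then show "w i = (scale t fundamental_cycle + two_variable_differential 0) i"
      using w(1) t by cases (auto simp: fundamental_cycle_def two_variable_differential_def vectors_def)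
  qed
  with t(1) show "\<exists>t\<in>carrier (polynomial_ring n). \<exists>y\<in>vectors n 2.
      w = scale t fundamental_cycle + two_variable_differential y"
    using vectors_zero by blast
next
  fix t :: "'k mpoly"
  assume t: "t \<in> carrier (polynomial_ring n)"
  have "scale t fundamental_cycle \<in> two_variable_differential ` vectors n 2 \<longleftrightarrow>
      (\<exists>w\<in>vectors n 2. t = variable 2 * w 0 - variable 1 * w 1)"
    by (simp add: two_variable_differential_def image_iff scale_fundamental_cycle_eq_iff)
  also have "\<dots> \<longleftrightarrow> t \<in> first_variables_ideal n 2"
    unfolding two_variables_ideal_iff[OF n]
  proof safe
    fix w :: "nat \<Rightarrow> 'k mpoly"
    assume w: "w \<in> vectors n 2"
    show "\<exists>p\<in>carrier (polynomial_ring n). \<exists>q\<in>carrier (polynomial_ring n).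
        variable 2 * w 0 - variable 1 * w 1 = variable 1 * p + variable 2 * q"
      using w by (intro bexI[of _ "- w 1"] bexI[of _ "w 0"]) (auto simp: vectors_def)
  next
    fix p q :: "'k mpoly"
    assume "p \<in> carrier (polynomial_ring n)" "q \<in> carrier (polynomial_ring n)"
    then show "\<exists>w\<in>vectors n 2. variable 1 * p + variable 2 * q = variable 2 * w 0 - variable 1 * w 1"
      by (intro bexI[of _ "\<lambda>i. if i = 0 then q else if i = 1 then - p else 0"]) (auto simp: vectors_def)
  qed
  finally show "scale t fundamental_cycle \<in> two_variable_differential ` vectors n 2 \<longleftrightarrow>
      t \<in> first_variables_ideal n 2" .
qed (use n in \<open>auto simp: two_variable_differential_def fundamental_cycle_def vectors_def fun_eq_iff
      algebra_simps\<close>)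

subsection \<open>The cone of multiplication by the next variable\<close>

definition lower :: "nat \<Rightarrow> (nat \<Rightarrow> 'a::zero) \<Rightarrow> nat \<Rightarrow> 'a" where
  "lower r w = (\<lambda>i. if i < r then w i else 0)"

definition upper :: "nat \<Rightarrow> (nat \<Rightarrow> 'a::zero) \<Rightarrow> nat \<Rightarrow> 'a" where
  "upper r w = (\<lambda>i. if i < r then w (i + r) else 0)"

text \<open>The second block is not cut off, so that stacking applies to weights as well; for
  \<open>v\<close> in \<open>vectors n r\<close> the result vanishes from \<open>2 * r\<close>
  on.\<close>

definition stack :: "nat \<Rightarrow> (nat \<Rightarrow> 'a) \<Rightarrow> (nat \<Rightarrow> 'a) \<Rightarrow> nat \<Rightarrow> 'a" where
  "stack r u v = (\<lambda>i. if i < r then u i else v (i - r))"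

lemma lower_mem [simp]: "w \<in> vectors n (2 * r) \<Longrightarrow> lower r w \<in> vectors n r"
  and upper_mem [simp]: "w \<in> vectors n (2 * r) \<Longrightarrow> upper r w \<in> vectors n r"
  and stack_mem [simp]: "u \<in> vectors n r \<Longrightarrow> v \<in> vectors n r \<Longrightarrow> stack r u v \<in> vectors n (2 * r)"
  by (auto simp: lower_def upper_def stack_def vectors_def)

lemma stack_lower_upper: "w \<in> vectors n (2 * r) \<Longrightarrow> stack r (lower r w) (upper r w) = w"
  by (auto simp: lower_def upper_def stack_def vectors_def fun_eq_iff)

lemma lower_stack: "u \<in> vectors n r \<Longrightarrow> lower r (stack r u v) = u"
  and upper_stack: "v \<in> vectors n r \<Longrightarrow> upper r (stack r u v) = v"
  by (auto simp: lower_def upper_def stack_def vectors_def fun_eq_iff)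

lemma stack_add: "stack r u v + stack r u' v' = stack r (u + u') (v + v')"
  by (simp add: stack_def fun_eq_iff)

lemma scale_stack: "scale p (stack r u v) = stack r (scale p u) (scale p v)"
  by (simp add: stack_def fun_eq_iff)

lemma stack_eq_iff:
  assumes "u \<in> vectors n r" "u' \<in> vectors n r"
  shows "stack r u v = stack r u' v' \<longleftrightarrow> u = u' \<and> v = v'"
proof
  assume eq: "stack r u v = stack r u' v'"
  have "u = u'"
    using arg_cong[OF eq, of "lower r"] assms by (simp add: lower_stack)
  moreover have "v i = v' i" for i
    using fun_cong[OF eq, of "i + r"] by (simp add: stack_def)
  ultimately show "u = u' \<and> v = v'"
    by blast
qed simp

lemma stack_zero [simp]: "stack r 0 0 = 0"
  by (simp add: stack_def fun_eq_iff)

lemma stack_fundamental_cycle: "2 \<le> r \<Longrightarrow> stack r fundamental_cycle 0 = fundamental_cycle"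
  by (auto simp: stack_def fundamental_cycle_def fun_eq_iff)

lemma stack_scale_fundamental_cycle:
  "2 \<le> r \<Longrightarrow> stack r (scale t fundamental_cycle) 0 = scale t fundamental_cycle"
  using scale_stack[of t r fundamental_cycle 0] by (simp add: stack_fundamental_cycle)

text \<open>The sign in the second block makes the square vanish: the first block of the square
  receives d (x v) and - x d v, which cancel.\<close>

definition cone_differential ::
  "nat \<Rightarrow> ('k::field) mpoly \<Rightarrow> ((nat \<Rightarrow> 'k mpoly) \<Rightarrow> nat \<Rightarrow> 'k mpoly) \<Rightarrow> (nat \<Rightarrow> 'k mpoly) \<Rightarrow> nat \<Rightarrow> 'k mpoly" where
  "cone_differential r x d w = stack r (d (lower r w) + scale x (upper r w)) (- d (upper r w))"

text \<open>Raising the weights by one encodes the twist D(1), so that multiplication by a variable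
  becomes a map of degree 2 from the second block to the first.\<close>

definition cone_weights :: "nat \<Rightarrow> (nat \<Rightarrow> nat) \<Rightarrow> nat \<Rightarrow> nat" where
  "cone_weights r c = stack r c (\<lambda>i. c i + 1)"

lemma vector_part_stack:
  "vector_part (cone_weights r c) j (stack r u v) = stack r (vector_part c j u) (vector_part c (j + 1) v)"
  by (auto simp: cone_weights_def stack_def fun_eq_iff ac_simps)

lemma lower_add: "lower r (v + w) = lower r v + lower r (w :: nat \<Rightarrow> 'a::monoid_add)"
  and upper_add: "upper r (v + w) = upper r v + upper r w"
  by (auto simp: lower_def upper_def fun_eq_iff)

lemma lower_scale: "lower r (scale p w) = scale p (lower r w)"
  and upper_scale: "upper r (scale p w) = scale p (upper r w)"
  by (auto simp: lower_def upper_def fun_eq_iff)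

context folded_koszul
begin

lemma cone_stack:
  assumes "u \<in> vectors n r" "v \<in> vectors n r"
  shows "cone_differential r x d (stack r u v) = stack r (d u + scale x v) (- d v)"
  using assms by (simp add: cone_differential_def lower_stack upper_stack)

lemma vectors_double_cases:
  assumes "w \<in> vectors n (2 * r)"
  obtains u v where "u \<in> vectors n r" "v \<in> vectors n r" "w = stack r u v"
  using assms stack_lower_upper[of w n r] by (metis lower_mem upper_mem)

lemma cone:
  assumes m: "Suc m \<le> n"
  shows "folded_koszul n (Suc m) (2 * r) (cone_weights r c) (cone_differential r (variable (Suc m)) d)"
proof
  let ?x = "variable (Suc m) :: 'k mpoly"
  let ?d = "cone_differential r ?x d"
  let ?z = "fundamental_cycle :: nat \<Rightarrow> 'k mpoly"
  let ?S = "carrier (polynomial_ring n) :: 'k mpoly set"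
  have x: "?x \<in> ?S"
    using m by simp
  have z: "?z \<in> vectors n r"
    using bounds by simp
  show "2 \<le> Suc m" "Suc m \<le> n" "2 \<le> 2 * r"
    using bounds m by auto
  show "cone_weights r c 0 = 1" "cone_weights r c 1 = 1"
    using bounds weights by (auto simp: cone_weights_def stack_def)
  show "?d (v + w) = ?d v + ?d w" for v w
    by (simp add: cone_differential_def stack_add lower_add upper_add add scale_add_right algebra_simps)
  show "?d (scale p w) = scale p (?d w)" for p w
    by (simp add: cone_differential_def scale_stack lower_scale upper_scale scale scale_add_right
        scale_uminus_right scale_scale mult.commute)
  show "?d ?z = 0"
    using cone_stack[OF z vectors_zero, of ?x] bounds
    by (simp add: stack_fundamental_cycle cycle zero)
  {
    fix w :: "nat \<Rightarrow> 'k mpoly"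
    assume "w \<in> vectors n (2 * r)"
    then obtain u v where uv: "u \<in> vectors n r" "v \<in> vectors n r" "w = stack r u v"
      by (rule vectors_double_cases)
    have closed': "d u + scale ?x v \<in> vectors n r" "- d v \<in> vectors n r"
      using uv x by (auto simp: closed)
    show "?d w \<in> vectors n (2 * r)"
      using closed' uv by (simp add: cone_stack)
    show "?d (?d w) = 0"
      using closed' uv by (simp add: cone_stack add scale square uminus scale_uminus_right zero)
    show "?d (vector_part (cone_weights r c) j w) = vector_part (cone_weights r c) (j + 2) (?d w)" for j
      using uv
      using vector_part_scale_variable[of c "j + 1" "Suc m" v]
      by (simp add: cone_stack vector_part_stack part vector_part_add vector_part_uminus ac_simps)
    assume "?d w = 0"
    then have "stack r (d u + scale ?x v) (- d v) = stack r 0 0"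
      using uv by (simp add: cone_stack)
    then have duv: "d u + scale ?x v = 0" and dv: "d v = 0"
      using stack_eq_iff[OF closed'(1) vectors_zero, of "- d v" 0] by auto
    \<comment> \<open>The second block is a cycle of the smaller complex. The equation for the first
      block will force its class to vanish.\<close>
    obtain s y where s: "s \<in> ?S" and y: "y \<in> vectors n r" and v: "v = scale s ?z + d y"
      using cycle_decomposition[OF uv(2) dv] by blast
    \<comment> \<open>Inserting the decomposition of \<open>v\<close> into d u + x v = 0 exhibits x
      s z as a boundary.\<close>
    have "scale (?x * s) ?z = d (- (u + scale ?x y))"
      using duv unfolding v uminus add scale
      by (simp add: scale_add_right scale_scale eq_neg_iff_add_eq_0 algebra_simps)
    moreover have "- (u + scale ?x y) \<in> vectors n r"
      using uv y x by simp
    ultimately have "?x * s \<in> first_variables_ideal n m"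
      using boundary_iff[of "?x * s"] s x by auto
    \<comment> \<open>Regularity enters: the new variable cancels modulo the previous ones, so s z,
      and with it \<open>v\<close>, is a boundary.\<close>
    then have "s \<in> first_variables_ideal n m"
      by (rule first_variables_ideal_cancel_variable[OF s]) simp
    then obtain y' where y': "y' \<in> vectors n r" "scale s ?z = d y'"
      using boundary_iff[OF s] by auto
    define v' where "v' = y' + y"
    have v': "v' \<in> vectors n r" "v = d v'"
      using y y' by (auto simp: v'_def v add)
    \<comment> \<open>Since d (x v') = x v, correcting \<open>u\<close> by x v' yields a cycle of
      the smaller complex.\<close>
    have "u + scale ?x v' \<in> vectors n r" "d (u + scale ?x v') = 0"
      using uv v' x duv by (auto simp: add scale)
    then obtain t y'' where t: "t \<in> ?S" and y'': "y'' \<in> vectors n r"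
      and u: "u + scale ?x v' = scale t ?z + d y''"
      using cycle_decomposition by blast
    \<comment> \<open>The entry - v' produces \<open>v\<close> in the second block and removes the
      correction x v' in the first.\<close>
    have "scale t ?z + ?d (stack r y'' (- v')) = w"
    proof -
      have "scale t ?z + ?d (stack r y'' (- v')) =
          stack r (scale t ?z) 0 + stack r (d y'' + scale ?x (- v')) (d v')"
        using y'' v' bounds by (simp add: cone_stack stack_scale_fundamental_cycle uminus)
      also have "\<dots> = stack r (scale t ?z + (d y'' + scale ?x (- v'))) (d v')"
        by (simp add: stack_add)
      also have "scale t ?z + (d y'' + scale ?x (- v')) = u"
        using u by (simp add: scale_uminus_right algebra_simps)
      finally show ?thesis
        unfolding uv(3) v'(2) .
    qed
    moreover have "stack r y'' (- v') \<in> vectors n (2 * r)"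
      using y'' v' by simp
    ultimately show "\<exists>t\<in>?S. \<exists>y\<in>vectors n (2 * r). w = scale t ?z + ?d y"
      using t by metis
  next
    fix t :: "'k mpoly"
    assume t: "t \<in> ?S"
    have tz: "scale t ?z = stack r (scale t ?z) 0"
      using bounds by (simp add: stack_scale_fundamental_cycle)
    show "scale t ?z \<in> ?d ` vectors n (2 * r) \<longleftrightarrow> t \<in> first_variables_ideal n (Suc m)"
    proof
      assume "scale t ?z \<in> ?d ` vectors n (2 * r)"
      then obtain u v where uv: "u \<in> vectors n r" "v \<in> vectors n r"
        and "scale t ?z = ?d (stack r u v)"
        by (auto elim!: vectors_double_cases)
      then have "stack r (scale t ?z) 0 = stack r (d u + scale ?x v) (- d v)"
        using tz by (simp add: cone_stack)
      then have duv: "scale t ?z = d u + scale ?x v" and dv: "d v = 0"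
        using stack_eq_iff[of "scale t ?z" n r "d u + scale ?x v" 0 "- d v"] uv z t x
        by (simp_all add: closed)
      obtain s y where s: "s \<in> ?S" and y: "y \<in> vectors n r" and v: "v = scale s ?z + d y"
        using cycle_decomposition[OF uv(2) dv] by blast
      \<comment> \<open>Inserting the decomposition of \<open>v\<close> leaves a multiple of z that
        is a boundary in the smaller complex, so t - x s lies in the smaller ideal.\<close>
      have "scale (t - ?x * s) ?z = d (u + scale ?x y)"
        using duv unfolding v by (simp add: add scale scale_add_right scale_diff_left scale_scale)
      moreover have "u + scale ?x y \<in> vectors n r"
        using uv y x by simp
      ultimately have "t - ?x * s \<in> first_variables_ideal n m"
        using boundary_iff[of "t - ?x * s"] t s x by auto
      then show "t \<in> first_variables_ideal n (Suc m)"
        unfolding first_variables_ideal_Suc[OF m] using s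
        by (intro bexI[of _ "t - ?x * s"] bexI[of _ s]) auto
    next
      assume "t \<in> first_variables_ideal n (Suc m)"
      then obtain q s where q: "q \<in> first_variables_ideal n m" and s: "s \<in> ?S"
        and t_eq: "t = q + ?x * s"
        unfolding first_variables_ideal_Suc[OF m] by blast
      have "q \<in> ?S"
        using q first_variables_ideal_subset by blast
      then obtain u where u: "u \<in> vectors n r" "scale q ?z = d u"
        using boundary_iff q by auto
      \<comment> \<open>The first block becomes q z + x s z = t z, and the second vanishes because z
        is a cycle.\<close>
      have "?d (stack r u (scale s ?z)) = stack r (scale t ?z) 0"
        using u z s by (simp add: cone_stack scale cycle t_eq scale_add_left scale_scale)
      with tz have "scale t ?z = ?d (stack r u (scale s ?z))"
        by (rule trans[OF _ sym])
      then show "scale t ?z \<in> ?d ` vectors n (2 * r)"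
        using u s z by auto
    qed
  }
qed

end

section \<open>Existence, by adding one variable at a time\<close>

lemma folded_koszul_exists:
  assumes "2 \<le> m" "m \<le> n"
  shows "\<exists>c d. folded_koszul n m (2 ^ (m - 1)) c (d :: (nat \<Rightarrow> ('k::field) mpoly) \<Rightarrow> _)"
  using assms
proof (induction m rule: dec_induct)
  case base
  then show ?case
    using folded_koszul_two by force
next
  case (step m)
  then obtain c and d :: "(nat \<Rightarrow> 'k mpoly) \<Rightarrow> nat \<Rightarrow> 'k mpoly"
    where "folded_koszul n m (2 ^ (m - 1)) c d"
    by auto
  \<comment> \<open>The case split on \<open>m\<close> resolves the truncated subtraction: for
    positive m, doubling \<open>2 ^ (m - 1)\<close> gives \<open>2 ^ m\<close>.\<close>
  from folded_koszul.cone[OF this] step show ?case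
    by (cases m) auto
qed

section \<open>Homology\<close>

text \<open>Addition in the modules at hand is that of the underlying type, hence so are their cosets.\<close>

lemma a_r_coset_eq: "add M = (+) \<Longrightarrow> N +>\<^bsub>M\<^esub> x = (\<lambda>b. b + x) ` N"
  by (auto simp: a_r_coset_def')

lemma carrier_quotient_module:
  "add M = (+) \<Longrightarrow> carrier (quotient_module M N) = (\<lambda>x. (\<lambda>b. b + x) ` N) ` carrier M"
  by (auto simp: quotient_module_def A_RCOSETS_def' a_r_coset_eq)

section \<open>Arithmetic of cosets, for the boundaries and for the ideal alike\<close>

context
  fixes N :: "'a::ab_group_add set"
  assumes zero: "0 \<in> N" and add: "\<And>x y. x \<in> N \<Longrightarrow> y \<in> N \<Longrightarrow> x + y \<in> N"
    and uminus: "\<And>x. x \<in> N \<Longrightarrow> - x \<in> N"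
begin

lemma mem_coset_iff: "x \<in> (\<lambda>b. b + y) ` N \<longleftrightarrow> x - y \<in> N"
  by (auto simp: image_iff) (metis diff_add_cancel)

lemma coset_eq_iff: "(\<lambda>b. b + x) ` N = (\<lambda>b. b + y) ` N \<longleftrightarrow> x - y \<in> N"
proof
  assume "(\<lambda>b. b + x) ` N = (\<lambda>b. b + y) ` N"
  moreover have "x \<in> (\<lambda>b. b + x) ` N"
    by (simp add: mem_coset_iff zero)
  ultimately show "x - y \<in> N"
    using mem_coset_iff by blast
next
  assume xy: "x - y \<in> N"
  have "z - x \<in> N \<longleftrightarrow> z - y \<in> N" for z
    using add[OF _ xy, of "z - x"] add[OF _ uminus[OF xy], of "z - y"] by auto
  then show "(\<lambda>b. b + x) ` N = (\<lambda>b. b + y) ` N"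
    by (auto simp only: set_eq_iff mem_coset_iff)
qed

lemma quotient_module_add:
  assumes "add M = (+)"
  shows "(\<lambda>b. b + x) ` N \<oplus>\<^bsub>quotient_module M N\<^esub> (\<lambda>b. b + y) ` N = (\<lambda>b. b + (x + y)) ` N"
proof -
  have "z - (x + y) \<in> N \<longleftrightarrow> (\<exists>u v. z = u + v \<and> u - x \<in> N \<and> v - y \<in> N)" for z
  proof
    assume "z - (x + y) \<in> N"
    then show "\<exists>u v. z = u + v \<and> u - x \<in> N \<and> v - y \<in> N"
      using zero by (intro exI[of _ "z - y"] exI[of _ y]) (simp add: algebra_simps)
  next
    assume "\<exists>u v. z = u + v \<and> u - x \<in> N \<and> v - y \<in> N"
    then obtain u v where "z = u + v" "u - x \<in> N" "v - y \<in> N"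
      by blast
    then show "z - (x + y) \<in> N"
      using add[of "u - x" "v - y"] by (simp add: algebra_simps)
  qed
  moreover have "(\<lambda>b. b + x) ` N \<oplus>\<^bsub>quotient_module M N\<^esub> (\<lambda>b. b + y) ` N =
      {u + v | u v. u \<in> (\<lambda>b. b + x) ` N \<and> v \<in> (\<lambda>b. b + y) ` N}"
    unfolding quotient_module_def by (simp only: ring.simps set_add_def' assms) blast
  ultimately show ?thesis
    by (simp only: set_eq_iff mem_coset_iff mem_Collect_eq simp_thms)
qed

text \<open>Scalar multiplication on the quotient is a union over all representatives of a coset.
  Each representative contributes the same coset, and there is at least one, so the union is that
  coset.\<close>

lemma quotient_module_smult:
  assumes "add M = (+)"
    and "\<And>b. b \<in> N \<Longrightarrow> r \<odot>\<^bsub>M\<^esub> (b + x) = r \<odot>\<^bsub>M\<^esub> b + r \<odot>\<^bsub>M\<^esub> x" "\<And>b. b \<in> N \<Longrightarrow> r \<odot>\<^bsub>M\<^esub> b \<in> N"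
  shows "r \<odot>\<^bsub>quotient_module M N\<^esub> ((\<lambda>b. b + x) ` N) = (\<lambda>b. b + r \<odot>\<^bsub>M\<^esub> x) ` N"
proof -
  have "N +>\<^bsub>M\<^esub> (r \<odot>\<^bsub>M\<^esub> y) = (\<lambda>b. b + r \<odot>\<^bsub>M\<^esub> x) ` N" if "y \<in> (\<lambda>b. b + x) ` N" for y
    using that assms(2,3) unfolding a_r_coset_eq[OF assms(1)] coset_eq_iff by auto
  moreover have "x \<in> (\<lambda>b. b + x) ` N"
    by (simp add: mem_coset_iff zero)
  ultimately show ?thesis
    unfolding quotient_module_def module.simps by blast
qed

end

section \<open>Homology of the folded Koszul complex\<close>

context folded_koszul
begin

lemma differential_module_vector_module:
  "differential_module (polynomial_ring n) (polynomial_grading n) (vector_module n r)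
    (vector_grading n r c) 2 d"
proof (intro differential_module.intro differential_module_axioms.intro graded_module_vector_module)
  have "d w \<in> vector_grading n r c (2 + j)" if "w \<in> vector_grading n r c j" for w j
    using that part[of w j] by (auto simp: vector_grading_def closed add.commute)
  then show "d \<in> graded_hom (polynomial_ring n) (vector_module n r) (vector_grading n r c)
      (vector_module n r) (shift_grading 2 (vector_grading n r c))"
    by (auto simp: graded_hom_def mod_hom_def shift_grading_def closed add scale)
qed (simp add: square)

lemma boundaries_zero: "0 \<in> boundaries (vector_module n r) d"
  and boundaries_add: "v \<in> boundaries (vector_module n r) d \<Longrightarrow> w \<in> boundaries (vector_module n r) d \<Longrightarrow>
    v + w \<in> boundaries (vector_module n r) d"
  and boundaries_uminus: "w \<in> boundaries (vector_module n r) d \<Longrightarrow> - w \<in> boundaries (vector_module n r) d"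
  and boundaries_scale: "p \<in> carrier (polynomial_ring n) \<Longrightarrow> w \<in> boundaries (vector_module n r) d \<Longrightarrow>
    scale p w \<in> boundaries (vector_module n r) d"
  unfolding boundaries_def
  by (auto simp: image_iff zero add[symmetric] uminus[symmetric] scale[symmetric]
      intro: bexI[of _ 0] vectors_add vectors_uminus vectors_scale)

lemma graded_iso_homology:
  assumes "m = n"
  shows "graded_iso (polynomial_ring n)
    (homology (vector_module n r) d) (homology_grading (vector_module n r) (vector_grading n r c) d)
    (residue_module n :: ('k mpoly, 'k mpoly set) module) (residue_grading n)"
proof -
  let ?S = "carrier (polynomial_ring n) :: 'k mpoly set"
  let ?D = "vector_module n r :: ('k mpoly, _) module"
  let ?Z = "?D\<lparr>carrier := cycles ?D d\<rparr>"
  let ?R = "regular_module (polynomial_ring n :: 'k mpoly ring)"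
  let ?z = "fundamental_cycle :: nat \<Rightarrow> 'k mpoly"
  define B where "B = boundaries ?D d"
  define I where "I = (first_variables_ideal n n :: 'k mpoly set)"
  \<comment> \<open>\<open>\<kappa> t\<close> is the homology class of t z, and
    \<open>\<rho> t\<close> the residue class of t.\<close>
  define \<kappa> where "\<kappa> = (\<lambda>t. (\<lambda>b. b + scale t ?z) ` B)"
  define \<rho> where "\<rho> = (\<lambda>t. (\<lambda>b. b + t) ` I)"
  \<comment> \<open>The inverse of multiplying by z, taken as a preimage: no representative has to
    be chosen, and the set of all such s is already a coset of the ideal.\<close>
  define f where "f = (\<lambda>A. {s \<in> ?S. scale s ?z \<in> A})"
  have add_Z: "add ?Z = (+)" and add_R: "add ?R = (+)"
    by (simp_all add: regular_module_def)
  note B = boundaries_zero[folded B_def] boundaries_add[folded B_def] boundaries_uminus[folded B_def]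
  note I = first_variables_ideal_zero[of n n, where 'a = 'k, folded I_def]
    first_variables_ideal_add[of _ n n, where 'a = 'k, folded I_def]
    first_variables_ideal_uminus[of _ n n, where 'a = 'k, folded I_def]
  have I_S: "I \<subseteq> ?S"
    by (simp add: I_def first_variables_ideal_subset)
  have z: "?z \<in> vectors n r"
    using bounds by simp
  have boundary: "scale t ?z \<in> B \<longleftrightarrow> t \<in> I" if "t \<in> ?S" for t
    using boundary_iff[OF that] assms by (simp add: B_def I_def boundaries_def)
  have cycles_iff: "w \<in> cycles ?D d \<longleftrightarrow> w \<in> vectors n r \<and> d w = 0" for w
    by (simp add: cycles_def)
  have scale_cycle: "scale t ?z \<in> cycles ?D d" if "t \<in> ?S" for t
    using that z by (simp add: cycles_iff scale cycle)
  have d_B: "d y \<in> B" if "y \<in> vectors n r" for y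
    using that by (simp add: B_def boundaries_def)
  have \<kappa>_eq: "(\<lambda>b. b + w) ` B = \<kappa> t" if "w = scale t ?z + d y" "y \<in> vectors n r" for w t y
    using that d_B by (simp add: \<kappa>_def coset_eq_iff[OF B])
  have f_\<kappa>: "f (\<kappa> t) = \<rho> t" if t: "t \<in> ?S" for t
  proof -
    have "s \<in> ?S \<and> scale s ?z \<in> \<kappa> t \<longleftrightarrow> s \<in> \<rho> t" for s
    proof (cases "s \<in> ?S")
      case True
      then show ?thesis
        using boundary[of "s - t"] t
        by (simp add: \<kappa>_def \<rho>_def mem_coset_iff[OF B] mem_coset_iff[OF I] scale_diff_left)
    next
      case False
      then show ?thesis
        using I_S t by (auto simp: \<rho>_def)
    qed
    then show ?thesis
      by (auto simp: f_def)
  qed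
  \<comment> \<open>Both equations say that s - t lies in the ideal, by \<open>boundary\<close>;
    injectivity of \<open>f\<close> follows.\<close>
  have \<kappa>_inj: "\<kappa> s = \<kappa> t \<longleftrightarrow> \<rho> s = \<rho> t" if "s \<in> ?S" "t \<in> ?S" for s t
    using boundary[of "s - t"] that
    by (simp add: \<kappa>_def \<rho>_def coset_eq_iff[OF B] coset_eq_iff[OF I] scale_diff_left)
  have H: "homology ?D d = quotient_module ?Z B"
    by (simp add: homology_def B_def)
  have R: "residue_module n = quotient_module ?R I"
    by (simp add: residue_module_def irrelevant_ideal_eq I_def)
  have carrier_H: "carrier (homology ?D d) = \<kappa> ` ?S"
  proof -
    have "carrier (homology ?D d) = (\<lambda>w. (\<lambda>b. b + w) ` B) ` cycles ?D d"
      unfolding H by (simp add: carrier_quotient_module[OF add_Z])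
    also have "\<dots> = \<kappa> ` ?S"
    proof
      show "(\<lambda>w. (\<lambda>b. b + w) ` B) ` cycles ?D d \<subseteq> \<kappa> ` ?S"
        using cycle_decomposition \<kappa>_eq by (fastforce simp: cycles_iff)
      show "\<kappa> ` ?S \<subseteq> (\<lambda>w. (\<lambda>b. b + w) ` B) ` cycles ?D d"
        using scale_cycle by (auto simp: \<kappa>_def)
    qed
    finally show ?thesis .
  qed
  have carrier_R: "carrier (residue_module n) = \<rho> ` ?S"
    unfolding R by (simp add: carrier_quotient_module[OF add_R] \<rho>_def) (simp add: regular_module_def)
  have add_H: "\<kappa> s \<oplus>\<^bsub>homology ?D d\<^esub> \<kappa> t = \<kappa> (s + t)" for s t
    unfolding H \<kappa>_def scale_add_left by (rule quotient_module_add[OF B add_Z])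
  have add_residue: "\<rho> s \<oplus>\<^bsub>residue_module n\<^esub> \<rho> t = \<rho> (s + t)" for s t
    unfolding R \<rho>_def by (rule quotient_module_add[OF I add_R])
  have smult_H: "p \<odot>\<^bsub>homology ?D d\<^esub> \<kappa> t = \<kappa> (p * t)" if "p \<in> ?S" for p t
    unfolding H \<kappa>_def using quotient_module_smult[OF B add_Z, of p "scale t ?z"]
      boundaries_scale[OF that, folded B_def] by (simp add: scale_add_right scale_scale)
  have smult_residue: "p \<odot>\<^bsub>residue_module n\<^esub> \<rho> t = \<rho> (p * t)" if "p \<in> ?S" for p t
    unfolding R \<rho>_def using quotient_module_smult[OF I add_R, of p t]
      first_variables_ideal_mult[OF that, of _ n, folded I_def]
    by (simp add: regular_module_def distrib_left)
  have f_hom: "f \<in> mod_hom (polynomial_ring n) (homology ?D d) (residue_module n)"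
    by (auto simp: mod_hom_def carrier_H carrier_R f_\<kappa> add_H add_residue smult_H smult_residue)
  have f_bij: "bij_betw f (carrier (homology ?D d)) (carrier (residue_module n))"
    unfolding bij_betw_def carrier_H carrier_R
    by (auto simp: inj_on_def f_\<kappa> \<kappa>_inj image_image)
  \<comment> \<open>The weights 1 of the first two coordinates absorb the degrees of x_1 and x_2, so
    z has degree 0.\<close>
  have part_z: "vector_part c j (scale t ?z) = scale (homogeneous_part j t) ?z" for j t
    using weights by (auto simp: fun_eq_iff fundamental_cycle_def homogeneous_part_mult_variable)
  have grading_H: "homology_grading ?D (vector_grading n r c) d j = \<kappa> ` polynomial_grading n j" for j
  proof -
    have "homology_grading ?D (vector_grading n r c) d j =
        (\<lambda>w. (\<lambda>b. b + w) ` B) ` (cycles ?D d \<inter> vector_grading n r c j)"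
      by (simp add: homology_grading_def quotient_grading_def a_r_coset_eq[OF add_Z] B_def)
    also have "\<dots> = \<kappa> ` polynomial_grading n j"
    proof (intro equalityI image_subsetI)
      fix w assume "w \<in> cycles ?D d \<inter> vector_grading n r c j"
      then have w: "w \<in> vectors n r" "d w = 0" "vector_part c j w = w"
        by (auto simp: cycles_iff vector_grading_def)
      then obtain t y where t: "t \<in> ?S" and y: "y \<in> vectors n r" and w_eq: "w = scale t ?z + d y"
        using cycle_decomposition by blast
      \<comment> \<open>Projecting the decomposition to degree j leaves \<open>w\<close> fixed and
        makes the coefficient homogeneous; the boundary then comes from degree j - 2, as d has
        degree 2.\<close>
      have "w = scale (homogeneous_part j t) ?z + d (vector_part c (j - 2) y)"
        using w(3) part[OF y, of "j - 2"] unfolding w_eq by (simp add: vector_part_add part_z)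
      then have "(\<lambda>b. b + w) ` B = \<kappa> (homogeneous_part j t)"
        using y by (intro \<kappa>_eq[where y = "vector_part c (j - 2) y"]) auto
      then show "(\<lambda>b. b + w) ` B \<in> \<kappa> ` polynomial_grading n j"
        using t by (auto simp: mem_polynomial_grading_iff homogeneous_part_homogeneous_part)
    next
      fix t :: "'k mpoly"
      assume "t \<in> polynomial_grading n j"
      then have "t \<in> ?S" "homogeneous_part j t = t"
        by (auto simp: mem_polynomial_grading_iff)
      then have "scale t ?z \<in> cycles ?D d \<inter> vector_grading n r c j"
        using scale_cycle[of t] by (simp add: vector_grading_def part_z cycles_iff)
      then show "\<kappa> t \<in> (\<lambda>w. (\<lambda>b. b + w) ` B) ` (cycles ?D d \<inter> vector_grading n r c j)"
        by (auto simp: \<kappa>_def)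
    qed
    finally show ?thesis .
  qed
  have grading_R: "residue_grading n j = \<rho> ` polynomial_grading n j" for j
    by (simp add: residue_grading_def quotient_grading_def a_r_coset_eq[OF add_R] \<rho>_def
        irrelevant_ideal_eq I_def)
  have "f ` homology_grading ?D (vector_grading n r c) d j = residue_grading n j" for j
    unfolding grading_H grading_R image_image
    by (rule image_cong) (auto simp: f_\<kappa> mem_polynomial_grading_iff)
  with f_hom f_bij show ?thesis
    unfolding graded_iso_def by blast
qed

end

section \<open>The main result\<close>

theorem proposition3p8:
  fixes n :: nat
  assumes "n \<ge> 2"
  shows "\<exists>(D :: (('k::field) mpoly, nat \<Rightarrow> 'k mpoly) module) Dg d.
    differential_module (polynomial_ring n) (polynomial_grading n) D Dg 2 d \<and>
    free_of_rank (polynomial_ring n) D (2 ^ (n - 1)) \<and>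
    graded_iso (polynomial_ring n)
      (homology D d) (homology_grading D Dg d)
      (residue_module n) (residue_grading n)"
proof -
  \<comment> \<open>With m = n all variables have entered, so the ideal in
    \<open>boundary_iff\<close> is the irrelevant ideal.\<close>
  obtain c and d :: "(nat \<Rightarrow> 'k mpoly) \<Rightarrow> nat \<Rightarrow> 'k mpoly"
    where "folded_koszul n n (2 ^ (n - 1)) c d"
    using folded_koszul_exists[OF assms order_refl] by blast
  then interpret folded_koszul n n "2 ^ (n - 1)" c d .
  show ?thesis
    using differential_module_vector_module free_of_rank_vector_module graded_iso_homology by blast
qed

end
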